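(* Let $\theta,\beta>0$ and $\nu_0=Be(1,\theta)$. On a common probability space, let $(v_n)_{n\ge1}$ be an exchangeable sequence driven by a Dirichlet process with parameters $(\beta,\nu_0)$, i.e. $\nu\sim\mathrm{DP}(\beta,\nu_0)$ and, given $\nu$, the $v_n$ are i.i.d. with distribution $\nu$; and let $v\sim Be(1,\theta)$. Let $P_\beta=\sum_{n\ge1}w_n\delta_{z_n}$ with $w_n=v_n\prod_{j=1}^{n-1}(1-v_j)$, and let $P'=\sum_{n\ge1}w_n'\delta_{z_n}$ with $w_n'=v(1-v)^{n-1}$ (a geometric process with parameters $(1,\theta,P_0)$), sharing the same locations $(z_n)_{n\ge1}$. Then, almost surely, $$D_{\mathrm{KL}}(P_\beta\|P')=\sum_{n=1}^{\infty}\left[\prod_{k=1}^{n-1}(1-v_k)\right]d(v_n\|v).$$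
   Context: $Be(a,b)$ is the beta distribution with mean $a/(a+b)$. $\mathrm{DP}(\beta,\nu_0)$ is the (law of the) Dirichlet process with concentration parameter $\beta$ and base probability measure $\nu_0$, a random probability measure on $[0,1]$. The locations $(z_n)_{n\ge1}$ are i.i.d. from a non-atomic probability distribution $P_0$ on a Polish space and independent of the weights. Since the locations are shared, the Kullback-Leibler divergence is the random variable $D_{\mathrm{KL}}(P_\beta\|P')=\sum_{n=1}^\infty w_n\log\frac{w_n}{w_n'}$. The binary divergence is, for $x,y\in(0,1)$, $d(x\|y)=x\log\frac{x}{y}+(1-x)\log\frac{1-x}{1-y}$. Empty products equal $1$. *)

theory Defs
  imports "HOL-Probability.Probability"
begin

text \<open>Sequences are indexed from 0 throughout, so index \<open>n\<close> stands for the mathematical index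
  \<open>n + 1\<close>.\<close>

definition beta_density :: "real \<Rightarrow> real \<Rightarrow> real \<Rightarrow> real" where
  "beta_density a b x =
     (if 0 < x \<and> x < 1 then x powr (a - 1) * (1 - x) powr (b - 1) / Beta a b else 0)"

text \<open>A law on \<^term>\<open>borel :: real measure\<close> concentrated on \<open>(0, 1)\<close>.\<close>

definition beta_distribution :: "real \<Rightarrow> real \<Rightarrow> real measure" where
  "beta_distribution a b = density lborel (\<lambda>x. ennreal (beta_density a b x))"

text \<open>Unit-rate gamma law of shape \<open>a \<ge> 0\<close>; by convention, shape 0 is the point mass at 0.\<close>

definition gamma_distribution :: "real \<Rightarrow> real measure" where
  "gamma_distribution a =
     (if a > 0
      then density lborel (\<lambda>x. ennreal (if x > 0 then x powr (a - 1) * exp (- x) / Gamma a else 0))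
      else return borel 0)"

text \<open>The Dirichlet distribution in Ferguson's form: normalised independent gamma variables. This
  covers parameters some (but not all) of which vanish, the corresponding coordinates being 0.\<close>

definition dirichlet_distribution :: "'i set \<Rightarrow> ('i \<Rightarrow> real) \<Rightarrow> ('i \<Rightarrow> real) measure" where
  "dirichlet_distribution I \<alpha> =
     distr (Pi\<^sub>M I (\<lambda>i. gamma_distribution (\<alpha> i))) (Pi\<^sub>M I (\<lambda>_. borel))
       (\<lambda>g. \<lambda>i\<in>I. g i / (\<Sum>j\<in>I. g j))"

text \<open>\<open>is_dirichlet_process M \<beta> \<nu>\<^sub>0 \<nu>\<close>: the random probability measure \<open>\<nu>\<close>, defined on the
  probability space \<open>M\<close>, has law \<open>DP(\<beta>, \<nu>\<^sub>0)\<close>, i.e. its values on every finite measurable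
  partition are jointly Dirichlet distributed. Cells of a partition may be empty.\<close>

definition is_dirichlet_process ::
  "'w measure \<Rightarrow> real \<Rightarrow> 'a measure \<Rightarrow> ('w \<Rightarrow> 'a measure) \<Rightarrow> bool" where
  "is_dirichlet_process M \<beta> \<nu>\<^sub>0 \<nu> \<longleftrightarrow>
     \<nu> \<in> M \<rightarrow>\<^sub>M prob_algebra \<nu>\<^sub>0 \<and>
     (\<forall>(k::nat) A. (\<forall>i<k. A i \<in> sets \<nu>\<^sub>0) \<longrightarrow> disjoint_family_on A {..<k} \<longrightarrow>
        (\<Union>i<k. A i) = space \<nu>\<^sub>0 \<longrightarrow>
        distr M (Pi\<^sub>M {..<k} (\<lambda>_. borel)) (\<lambda>\<omega>. \<lambda>i\<in>{..<k}. measure (\<nu> \<omega>) (A i))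
          = dirichlet_distribution {..<k} (\<lambda>i. \<beta> * measure \<nu>\<^sub>0 (A i)))"

text \<open>\<open>is_cond_iid M N \<nu> X\<close>: given the random probability measure \<open>\<nu>\<close> on \<open>N\<close>, the \<open>X i\<close> are i.i.d.
  with distribution \<open>\<nu>\<close>. Conditioning is on the sigma-algebra generated by \<open>\<nu>\<close>.\<close>

definition is_cond_iid ::
  "'w measure \<Rightarrow> 'a measure \<Rightarrow> ('w \<Rightarrow> 'a measure) \<Rightarrow> (nat \<Rightarrow> 'w \<Rightarrow> 'a) \<Rightarrow> bool" where
  "is_cond_iid M N \<nu> X \<longleftrightarrow>
     \<nu> \<in> M \<rightarrow>\<^sub>M prob_algebra N \<and>
     (\<forall>i. X i \<in> M \<rightarrow>\<^sub>M N) \<and>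
     (\<forall>n A. (\<forall>i<n. A i \<in> sets N) \<longrightarrow>
        (AE \<omega> in M.
           real_cond_exp M (vimage_algebra (space M) \<nu> (prob_algebra N))
             (indicator {\<omega> \<in> space M. \<forall>i<n. X i \<omega> \<in> A i}) \<omega>
           = (\<Prod>i<n. measure (\<nu> \<omega>) (A i))))"

definition stick_weight :: "(nat \<Rightarrow> real) \<Rightarrow> nat \<Rightarrow> real" where
  "stick_weight v n = v n * (\<Prod>j<n. 1 - v j)"

definition geometric_weight :: "real \<Rightarrow> nat \<Rightarrow> real" where
  "geometric_weight v n = v * (1 - v) ^ n"

text \<open>The measure \<open>\<Sum>n. w n \<cdot> \<delta>(z n)\<close>, as the image of the weighted counting measure.\<close>

definition atomic_measure :: "(nat \<Rightarrow> real) \<Rightarrow> (nat \<Rightarrow> 'a::topological_space) \<Rightarrow> 'a measure" where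
  "atomic_measure w z = distr (point_measure UNIV (\<lambda>n. ennreal (w n))) borel z"

definition binary_divergence :: "real \<Rightarrow> real \<Rightarrow> real" where
  "binary_divergence x y = x * ln (x / y) + (1 - x) * ln ((1 - x) / (1 - y))"

end

theory Submission
  imports Defs
begin

text \<open>
  Write \<open>S n = (\<Prod>j<n. 1 - v j)\<close> for the length of stick left after \<open>n\<close> breaks, so that
  \<open>w n = S n - S (Suc n)\<close>, and \<open>T n = S n * ln (S n / (1 - u) ^ n)\<close>. The chain rule for the
  divergence, applied to one break, gives
  \<open>S n * d(v n \<parallel> u) = w n * ln (w n / w' n) + (T (Suc n) - T n)\<close>. The two series thus differ by a
  telescoping one, and they have the same sum as soon as \<open>T\<close> tends to 0
  (\<open>stick_breaking_divergence_series\<close>).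

  Both the limit of \<open>T\<close> and the absolute convergence of the first series follow from one fact:
  almost surely \<open>S n\<close> decays geometrically (\<open>AE_stick_remainder_geometric\<close>). Absolute
  convergence is essential, since the divergence is a Lebesgue integral, which represents only
  absolutely convergent series. For the decay, a set that the base measure of the Dirichlet process
  does not charge is almost surely not charged by \<open>\<nu>\<close> (\<open>AE_dirichlet_process_null_set\<close>). Hence all
  \<open>v n\<close> lie in \<open>(0, 1)\<close>, and almost every \<open>\<nu>\<close> gives mass more than \<open>a\<close> to \<open>{a<..}\<close> for some
  \<open>a > 0\<close>. Given such a \<open>\<nu>\<close>, each break leaves at most the fraction \<open>1 - a\<close> of the stick with
  conditional probability more than \<open>a\<close>, independently of the others, so the conditional mean of
  \<open>S n\<close> is at most \<open>(1 - a\<^sup>2) ^ n\<close> (\<open>integral_prod_cond_iid\<close>). Markov's inequality and the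
  Borel-Cantelli lemma turn this into an almost sure bound.

  Finally, non-atomic independent locations are almost surely distinct. For distinct locations the
  density of \<open>P\<close> with respect to \<open>P'\<close> is \<open>w n / w' n\<close> at \<open>z n\<close>, so the divergence of the two
  measures is the first series (\<open>KL_divergence_atomic_measure\<close>).
\<close>

section \<open>Null sets of beta laws and Dirichlet processes\<close>

lemma AE_beta_distribution: "AE x in beta_distribution a b. 0 < x \<and> x < 1"
proof -
  have "beta_density a b \<in> borel_measurable borel"
    unfolding beta_density_def[abs_def] by measurable
  then show ?thesis
    unfolding beta_distribution_def by (subst AE_density) (auto simp: beta_density_def)
qed

lemma sets_beta_distribution [simp]: "sets (beta_distribution a b) = sets borel"
  by (simp add: beta_distribution_def)

lemma measure_beta_distribution_eq_0:
  assumes "A \<in> sets borel" "A \<inter> {0<..<1} = {}"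
  shows "measure (beta_distribution a b) A = 0"
proof -
  have "AE x in beta_distribution a b. x \<notin> A"
    using AE_beta_distribution by eventually_elim (use assms(2) in auto)
  then have "emeasure (beta_distribution a b) A = 0"
    using assms(1) sets.sets_into_space[of A "beta_distribution a b"]
    by (subst (asm) AE_iff_measurable[where N = A]) auto
  then show ?thesis
    by (simp add: measure_def)
qed

lemma sets_gamma_distribution [simp]: "sets (gamma_distribution a) = sets borel"
  by (simp add: gamma_distribution_def)

lemma prob_space_gamma_distribution: "prob_space (gamma_distribution a)"
proof (cases "a > 0")
  case True
  define f :: "real \<Rightarrow> real" where "f t = indicator {0..} t * t powr (a - 1) / exp t" for t
  have f_int: "(\<integral>\<^sup>+t. ennreal (f t) \<partial>lborel) = ennreal (Gamma a)"
    unfolding f_def by (rule Gamma_conv_nn_integral_real[OF True, symmetric])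
  have pos: "Gamma a > 0"
    using True by (rule Gamma_real_pos)
  have "(\<integral>\<^sup>+t. ennreal (if t > 0 then t powr (a - 1) * exp (- t) / Gamma a else 0) \<partial>lborel)
        = (\<integral>\<^sup>+t. ennreal (1 / Gamma a) * ennreal (f t) \<partial>lborel)"
    using pos by (intro nn_integral_cong)
      (auto simp: f_def exp_minus field_simps indicator_def simp flip: ennreal_mult)
  also have "\<dots> = ennreal (1 / Gamma a) * ennreal (Gamma a)"
    by (subst nn_integral_cmult) (simp_all add: f_int, simp add: f_def)
  also have "\<dots> = 1"
    using pos by (simp flip: ennreal_mult)
  finally show ?thesis
    using True by (intro prob_spaceI) (simp add: gamma_distribution_def emeasure_density)
next
  case False
  then show ?thesis
    by (simp add: gamma_distribution_def prob_space_return)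
qed

text \<open>A gamma variable of shape 0 vanishes, and so does its share of the total. This holds also when
  the total is 0, as \<open>0 / 0 = 0\<close>.\<close>

lemma AE_dirichlet_distribution_eq_0:
  assumes "finite I" "i \<in> I" "\<alpha> i = 0"
  shows "AE p in dirichlet_distribution I \<alpha>. p i = 0"
proof -
  have "AE g in Pi\<^sub>M I (\<lambda>i. gamma_distribution (\<alpha> i)). g i = 0"
  proof (rule AE_PiM_component)
    show "AE g in gamma_distribution (\<alpha> i). g = 0"
      unfolding gamma_distribution_def assms(3) by (simp add: AE_return)
  qed (use assms prob_space_gamma_distribution in auto)
  then have zero: "AE g in Pi\<^sub>M I (\<lambda>i. gamma_distribution (\<alpha> i)).
      (\<lambda>i\<in>I. g i / (\<Sum>j\<in>I. g j)) i = 0"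
    using assms by auto
  have sets: "sets (Pi\<^sub>M I (\<lambda>i. gamma_distribution (\<alpha> i))) = sets (Pi\<^sub>M I (\<lambda>_. borel))"
    by (rule sets_PiM_cong) auto
  have meas: "(\<lambda>g. \<lambda>i\<in>I. g i / (\<Sum>j\<in>I. g j))
      \<in> Pi\<^sub>M I (\<lambda>i. gamma_distribution (\<alpha> i)) \<rightarrow>\<^sub>M Pi\<^sub>M I (\<lambda>_. borel)"
    unfolding measurable_cong_sets[OF sets refl] by measurable
  show ?thesis
    unfolding dirichlet_distribution_def using zero assms(2)
    by (subst AE_distr_iff[OF meas]) auto
qed

text \<open>In the partition of the space into \<open>A\<close> and its complement, the Dirichlet parameter of \<open>A\<close>
  is 0.\<close>

lemma AE_dirichlet_process_null_set:
  assumes DP: "is_dirichlet_process M \<beta> \<nu>\<^sub>0 \<nu>"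
    and A: "A \<in> sets \<nu>\<^sub>0" "measure \<nu>\<^sub>0 A = 0"
  shows "AE \<omega> in M. measure (\<nu> \<omega>) A = 0"
proof -
  define C where "C i = (if i = 0 then A else space \<nu>\<^sub>0 - A)" for i :: nat
  let ?f = "\<lambda>\<omega>. \<lambda>i\<in>{..<2::nat}. measure (\<nu> \<omega>) (C i)"
  have \<nu>: "\<nu> \<in> M \<rightarrow>\<^sub>M prob_algebra \<nu>\<^sub>0"
    using DP by (simp add: is_dirichlet_process_def)
  have C: "C i \<in> sets \<nu>\<^sub>0" for i
    using A by (auto simp: C_def)
  have two: "{..<2} = {0, Suc 0}"
    by auto
  have "(\<Union>i<2. C i) = space \<nu>\<^sub>0" "disjoint_family_on C {..<2}"
    using sets.sets_into_space[OF A(1)] by (auto simp: C_def disjoint_family_on_def two)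
  then have distr: "distr M (Pi\<^sub>M {..<2} (\<lambda>_. borel)) ?f
      = dirichlet_distribution {..<2} (\<lambda>i. \<beta> * measure \<nu>\<^sub>0 (C i))"
    using DP C unfolding is_dirichlet_process_def by blast
  have f: "?f \<in> M \<rightarrow>\<^sub>M Pi\<^sub>M {..<2} (\<lambda>_. borel)"
    by (intro measurable_restrict measurable_compose[OF \<nu> measurable_measure_prob_algebra] C)
  have "AE p in distr M (Pi\<^sub>M {..<2} (\<lambda>_. borel)) ?f. p 0 = 0"
    unfolding distr by (rule AE_dirichlet_distribution_eq_0) (auto simp: C_def A)
  from AE_distrD[OF f this] show ?thesis
    by (simp add: C_def)
qed

section \<open>Conditionally i.i.d. sequences\<close>

lemma subalgebra_vimage_algebra:
  assumes "f \<in> M \<rightarrow>\<^sub>M N"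
  shows "subalgebra M (vimage_algebra (space M) f N)"
  using measurable_sets[OF assms] measurable_space[OF assms]
  by (auto simp: subalgebra_def sets_vimage_algebra2)

text \<open>The marginal law of \<open>X i\<close> is the mean of \<open>\<nu>\<close>. To read it off the joint conditional law of the
  first \<open>Suc i\<close> variables, the earlier ones are left unconstrained.\<close>

lemma AE_cond_iid_not_in_null_set:
  assumes "prob_space M" and iid: "is_cond_iid M N \<nu> X"
    and A: "A \<in> sets N" and null: "AE \<omega> in M. measure (\<nu> \<omega>) A = 0"
  shows "AE \<omega> in M. X i \<omega> \<notin> A"
proof -
  interpret prob_space M by fact
  let ?F = "vimage_algebra (space M) \<nu> (prob_algebra N)"
  have \<nu>: "\<nu> \<in> M \<rightarrow>\<^sub>M prob_algebra N" and X[measurable]: "\<And>i. X i \<in> M \<rightarrow>\<^sub>M N"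
    using iid by (auto simp: is_cond_iid_def)
  interpret finite_measure_subalgebra M ?F
    by unfold_locales (rule subalgebra_vimage_algebra[OF \<nu>])
  define C where "C j = (if j = i then A else space N)" for j
  have C: "C j \<in> sets N" for j
    using A by (simp add: C_def)
  define E where "E = {\<omega> \<in> space M. X i \<omega> \<in> A}"
  have E: "{\<omega> \<in> space M. \<forall>j<Suc i. X j \<omega> \<in> C j} = E"
    using measurable_space[OF X] by (auto simp: C_def E_def less_Suc_eq)
  have E_sets: "E \<in> sets M"
    unfolding E_def using A by measurable
  have "AE \<omega> in M. real_cond_exp M ?F (indicator E) \<omega> = (\<Prod>j<Suc i. measure (\<nu> \<omega>) (C j))"
    using iid C unfolding is_cond_iid_def E[symmetric] by blast
  with null have zero: "AE \<omega> in M. real_cond_exp M ?F (indicator E) \<omega> = 0"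
    by eventually_elim (simp add: C_def)
  have "measure M E = (\<integral>\<omega>. indicator E \<omega> \<partial>M)"
    using E_sets by simp
  also have "\<dots> = (\<integral>\<omega>. real_cond_exp M ?F (indicator E) \<omega> \<partial>M)"
    by (rule real_cond_exp_int(2)[symmetric]) (use E_sets in \<open>simp add: emeasure_eq_measure\<close>)
  also have "\<dots> = 0"
    by (rule integral_eq_zero_AE[OF zero])
  finally show ?thesis
    by (subst AE_iff_measurable[OF E_sets]) (auto simp: E_def emeasure_eq_measure)
qed

text \<open>Conditional independence is given for rectangles only. Multiplying out both the product on the
  left and \<open>(c * \<nu> A + \<nu> (- A)) ^ n\<close> on the right yields one term for each set \<open>B\<close> of indices,
  with \<open>X i \<in> A\<close> exactly for \<open>i \<in> B\<close>. These events are rectangles, so the terms have equal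
  integrals over \<open>G\<close>.\<close>

lemma integral_prod_cond_iid:
  assumes "prob_space M" and iid: "is_cond_iid M N \<nu> X"
    and A: "A \<in> sets N" and G: "G \<in> sets (vimage_algebra (space M) \<nu> (prob_algebra N))"
  shows "(\<integral>\<omega>. indicator G \<omega> * (\<Prod>i<n. if X i \<omega> \<in> A then c else 1) \<partial>M)
       = (\<integral>\<omega>. indicator G \<omega> * (1 - (1 - c) * measure (\<nu> \<omega>) A) ^ n \<partial>M)"
proof -
  interpret prob_space M by fact
  let ?F = "vimage_algebra (space M) \<nu> (prob_algebra N)"
  have \<nu>: "\<nu> \<in> M \<rightarrow>\<^sub>M prob_algebra N" and X[measurable]: "\<And>i. X i \<in> M \<rightarrow>\<^sub>M N"
    using iid by (auto simp: is_cond_iid_def)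
  interpret finite_measure_subalgebra M ?F
    by unfold_locales (rule subalgebra_vimage_algebra[OF \<nu>])
  have G_sets[measurable]: "G \<in> sets M"
    using G subalg by (auto simp: subalgebra_def)
  have \<nu>_prob: "prob_space (\<nu> \<omega>)" "sets (\<nu> \<omega>) = sets N" if "\<omega> \<in> space M" for \<omega>
    using measurable_space[OF \<nu> that] by (auto simp: space_prob_algebra)
  define C where "C B i = (if i \<in> B then A else space N - A)" for B and i :: nat
  have C: "C B i \<in> sets N" for B i
    using A by (simp add: C_def)
  have meas_\<nu>[measurable]: "(\<lambda>\<omega>. measure (\<nu> \<omega>) S) \<in> borel_measurable M" if "S \<in> sets N" for S
    by (rule measurable_compose[OF \<nu> measurable_measure_prob_algebra[OF that]])
  define E where "E B = {\<omega> \<in> space M. \<forall>i<n. X i \<omega> \<in> C B i}" for B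
  have E_sets[measurable]: "E B \<in> sets M" for B
    unfolding E_def using C by measurable
  have int_E: "(\<integral>\<omega>. indicator G \<omega> * indicator (E B) \<omega> \<partial>M)
      = (\<integral>\<omega>. indicator G \<omega> * (\<Prod>i<n. measure (\<nu> \<omega>) (C B i)) \<partial>M)" for B
  proof -
    have "(\<integral>\<omega>. indicator G \<omega> * indicator (E B) \<omega> \<partial>M)
        = (\<integral>\<omega>. indicator G \<omega> * real_cond_exp M ?F (indicator (E B)) \<omega> \<partial>M)"
      by (rule real_cond_exp_intg(2)[symmetric])
         (use G in \<open>auto intro!: integrable_real_mult_indicator simp: emeasure_eq_measure\<close>)
    also have "\<dots> = (\<integral>\<omega>. indicator G \<omega> * (\<Prod>i<n. measure (\<nu> \<omega>) (C B i)) \<partial>M)"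
    proof (rule integral_cong_AE)
      have "AE \<omega> in M. real_cond_exp M ?F (indicator (E B)) \<omega> = (\<Prod>i<n. measure (\<nu> \<omega>) (C B i))"
        using iid C unfolding is_cond_iid_def E_def by blast
      then show "AE \<omega> in M. indicator G \<omega> * real_cond_exp M ?F (indicator (E B)) \<omega>
          = indicator G \<omega> * (\<Prod>i<n. measure (\<nu> \<omega>) (C B i))"
        by eventually_elim simp
    qed (use C in measurable)
    finally show ?thesis .
  qed
  have prod_X: "(\<Prod>i<n. if X i \<omega> \<in> A then c else 1)
      = (\<Sum>B\<in>Pow {..<n}. c ^ card B * indicator (E B) \<omega>)" if \<omega>: "\<omega> \<in> space M" for \<omega>
  proof -
    have "(\<Prod>i<n. if X i \<omega> \<in> A then c else 1)
        = (\<Prod>i<n. c * indicator A (X i \<omega>) + indicator (space N - A) (X i \<omega>))"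
      using measurable_space[OF X \<omega>] by (intro prod.cong) auto
    also have "\<dots> = (\<Sum>B\<in>Pow {..<n}. (\<Prod>i\<in>B. c * indicator A (X i \<omega>))
        * (\<Prod>i\<in>{..<n} - B. indicator (space N - A) (X i \<omega>)))"
      by (rule prod_add) simp
    also have "\<dots> = (\<Sum>B\<in>Pow {..<n}. c ^ card B * indicator (E B) \<omega>)"
    proof (rule sum.cong[OF refl])
      fix B assume "B \<in> Pow {..<n}"
      then have B: "B \<subseteq> {..<n}" "finite B"
        by (auto intro: finite_subset)
      have "(\<Prod>i\<in>B. indicator A (X i \<omega>)) * (\<Prod>i\<in>{..<n} - B. indicator (space N - A) (X i \<omega>))
          = (\<Prod>i<n. indicator (C B i) (X i \<omega>) :: real)"
        unfolding prod.subset_diff[OF B(1) finite_lessThan]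
        by (subst mult.commute) (auto intro!: arg_cong2[of _ _ _ _ "(*)"] prod.cong simp: C_def)
      also have "\<dots> = indicator (E B) \<omega>"
        using \<omega> by (auto simp: E_def indicator_def prod_zero_iff)
      finally show "(\<Prod>i\<in>B. c * indicator A (X i \<omega>))
          * (\<Prod>i\<in>{..<n} - B. indicator (space N - A) (X i \<omega>)) = c ^ card B * indicator (E B) \<omega>"
        by (simp add: prod.distrib mult.assoc)
    qed
    finally show ?thesis .
  qed
  have prod_\<nu>: "(1 - (1 - c) * measure (\<nu> \<omega>) A) ^ n
      = (\<Sum>B\<in>Pow {..<n}. c ^ card B * (\<Prod>i<n. measure (\<nu> \<omega>) (C B i)))"
    if \<omega>: "\<omega> \<in> space M" for \<omega>
  proof -
    interpret \<nu>: prob_space "\<nu> \<omega>"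
      by (rule \<nu>_prob(1)[OF \<omega>])
    have compl: "measure (\<nu> \<omega>) (space N - A) = 1 - measure (\<nu> \<omega>) A"
      using \<nu>.prob_compl[of A] \<nu>_prob(2)[OF \<omega>] A sets_eq_imp_space_eq[OF \<nu>_prob(2)[OF \<omega>]]
      by simp
    have "(1 - (1 - c) * measure (\<nu> \<omega>) A) ^ n
        = (\<Prod>i<n. c * measure (\<nu> \<omega>) A + measure (\<nu> \<omega>) (space N - A))"
      by (simp add: compl algebra_simps)
    also have "\<dots> = (\<Sum>B\<in>Pow {..<n}. (\<Prod>i\<in>B. c * measure (\<nu> \<omega>) A)
        * (\<Prod>i\<in>{..<n} - B. measure (\<nu> \<omega>) (space N - A)))"
      by (rule prod_add) simp
    also have "\<dots> = (\<Sum>B\<in>Pow {..<n}. c ^ card B * (\<Prod>i<n. measure (\<nu> \<omega>) (C B i)))"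
    proof (rule sum.cong[OF refl])
      fix B assume "B \<in> Pow {..<n}"
      then have B: "B \<subseteq> {..<n}"
        by auto
      have "(\<Prod>i\<in>B. measure (\<nu> \<omega>) A) * (\<Prod>i\<in>{..<n} - B. measure (\<nu> \<omega>) (space N - A))
          = (\<Prod>i<n. measure (\<nu> \<omega>) (C B i))"
        unfolding prod.subset_diff[OF B finite_lessThan]
        by (subst mult.commute) (auto intro!: arg_cong2[of _ _ _ _ "(*)"] prod.cong simp: C_def)
      then show "(\<Prod>i\<in>B. c * measure (\<nu> \<omega>) A)
          * (\<Prod>i\<in>{..<n} - B. measure (\<nu> \<omega>) (space N - A))
          = c ^ card B * (\<Prod>i<n. measure (\<nu> \<omega>) (C B i))"
        by (simp add: power_mult_distrib)
    qed
    finally show ?thesis .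
  qed
  have bdd: "norm (\<Prod>i<n. measure (\<nu> \<omega>) (C B i)) \<le> 1" if "\<omega> \<in> space M" for \<omega> B
    unfolding real_norm_def abs_prod
    by (rule prod_le_1) (use \<nu>_prob(1)[OF that] prob_space.prob_le_1 in \<open>auto\<close>)
  have integrable_\<nu>: "integrable M (\<lambda>\<omega>. indicator G \<omega> * (\<Prod>i<n. measure (\<nu> \<omega>) (C B i)))" for B
    by (rule integrable_const_bound[where B = 1])
       (use C bdd in \<open>auto intro!: AE_I2 simp: abs_mult indicator_def\<close>)
  have "(\<integral>\<omega>. indicator G \<omega> * (\<Prod>i<n. if X i \<omega> \<in> A then c else 1) \<partial>M)
      = (\<integral>\<omega>. (\<Sum>B\<in>Pow {..<n}. c ^ card B * (indicator G \<omega> * indicator (E B) \<omega>)) \<partial>M)"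
    by (intro Bochner_Integration.integral_cong)
       (simp_all only: prod_X sum_distrib_left mult.left_commute)
  also have "\<dots> = (\<Sum>B\<in>Pow {..<n}. c ^ card B * (\<integral>\<omega>. indicator G \<omega> * indicator (E B) \<omega> \<partial>M))"
    by (subst Bochner_Integration.integral_sum)
       (auto intro!: integrable_real_mult_indicator simp: emeasure_eq_measure)
  also have "\<dots> = (\<integral>\<omega>. (\<Sum>B\<in>Pow {..<n}.
      c ^ card B * (indicator G \<omega> * (\<Prod>i<n. measure (\<nu> \<omega>) (C B i)))) \<partial>M)"
    by (subst Bochner_Integration.integral_sum) (auto simp: int_E integrable_\<nu>)
  also have "\<dots> = (\<integral>\<omega>. indicator G \<omega> * (1 - (1 - c) * measure (\<nu> \<omega>) A) ^ n \<partial>M)"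
    by (intro Bochner_Integration.integral_cong)
       (simp_all only: prod_\<nu> sum_distrib_left mult.left_commute)
  finally show ?thesis .
qed

section \<open>Geometric decay of the remaining stick\<close>

text \<open>With the threshold \<open>sqrt q ^ n\<close>, Markov's inequality bounds the probability of exceeding it by
  \<open>q ^ n / sqrt q ^ n = sqrt q ^ n\<close>, which is summable; the Borel-Cantelli lemma applies.\<close>

lemma (in prob_space) AE_eventually_less_geometric:
  fixes Y :: "nat \<Rightarrow> 'a \<Rightarrow> real"
  assumes int: "\<And>n. integrable M (Y n)" and nonneg: "\<And>n \<omega>. 0 \<le> Y n \<omega>"
    and le: "\<And>n. expectation (Y n) \<le> q ^ n" and q: "0 < q" "q < 1"
  shows "AE \<omega> in M. eventually (\<lambda>n. Y n \<omega> < sqrt q ^ n) sequentially"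
proof -
  define B where "B n = {\<omega> \<in> space M. sqrt q ^ n \<le> Y n \<omega>}" for n
  have [measurable]: "Y n \<in> borel_measurable M" for n
    using int by simp
  have B[measurable]: "B n \<in> sets M" for n
    unfolding B_def by measurable
  have "prob (B n) \<le> sqrt q ^ n" for n
  proof -
    have "prob (B n) \<le> expectation (Y n) / sqrt q ^ n"
      unfolding B_def
      by (rule integral_Markov_inequality_measure[where A = "{}"]) (use int nonneg q in auto)
    also have "\<dots> \<le> q ^ n / sqrt q ^ n"
      using le q by (intro divide_right_mono) auto
    also have "\<dots> = sqrt q ^ n"
      using q by (simp add: real_div_sqrt flip: power_divide)
    finally show ?thesis .
  qed
  then have "summable (\<lambda>n. prob (B n))"
    using q by (intro summable_comparison_test'[OF summable_geometric[of "sqrt q"]]) auto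
  then have "AE \<omega> in M. eventually (\<lambda>n. \<omega> \<in> space M - B n) sequentially"
    by (intro borel_cantelli_AE1) (auto simp: emeasure_eq_measure)
  then show ?thesis
    by eventually_elim (auto simp: B_def not_le elim: eventually_mono)
qed

text \<open>The rate depends on \<open>\<nu>\<close> and has no positive lower bound on its distance from 1. The proof
  therefore works on the countably many events \<open>G k\<close>, generated by \<open>\<nu>\<close>, that \<open>\<nu>\<close> gives mass more
  than \<open>a k\<close> to \<open>{a k<..}\<close>. On each of them the rate is uniform, and together they have full
  measure.\<close>

lemma AE_stick_remainder_geometric:
  fixes v :: "nat \<Rightarrow> 'w \<Rightarrow> real"
  assumes "prob_space M" and iid: "is_cond_iid M borel \<nu> v"
    and null: "AE \<omega> in M. measure (\<nu> \<omega>) {..0} = 0"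
    and v01: "AE \<omega> in M. \<forall>i. 0 < v i \<omega> \<and> v i \<omega> < 1"
  shows "AE \<omega> in M. \<exists>r. 0 < r \<and> r < 1 \<and>
    eventually (\<lambda>n. (\<Prod>j<n. 1 - v j \<omega>) < r ^ n) sequentially"
proof -
  interpret prob_space M by fact
  let ?F = "vimage_algebra (space M) \<nu> (prob_algebra borel)"
  have \<nu>: "\<nu> \<in> M \<rightarrow>\<^sub>M prob_algebra borel" and v[measurable]: "\<And>i. v i \<in> M \<rightarrow>\<^sub>M borel"
    using iid by (auto simp: is_cond_iid_def)
  have \<nu>_prob: "prob_space (\<nu> \<omega>)" "sets (\<nu> \<omega>) = sets borel" if "\<omega> \<in> space M" for \<omega>
    using measurable_space[OF \<nu> that] by (auto simp: space_prob_algebra)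
  \<comment> \<open>The shift by 2 keeps \<open>a k\<close> strictly below 1, so that the rate \<open>1 - a k * a k\<close> is positive.\<close>
  define a :: "nat \<Rightarrow> real" where "a k = 1 / real (k + 2)" for k
  have a: "0 < a k" "a k < 1" for k
    by (auto simp: a_def)
  have q: "0 < 1 - a k * a k" "1 - a k * a k < 1" for k
    using a[of k] mult_strict_mono[of "a k" 1 "a k" 1] by auto
  have a_lim: "a \<longlonglongrightarrow> 0"
    unfolding a_def by (rule LIMSEQ_ignore_initial_segment[OF lim_1_over_n])
  define A where "A k = {a k<..}" for k
  define G where "G k = {\<omega> \<in> space M. a k < measure (\<nu> \<omega>) (A k)}" for k
  define Y where "Y k n \<omega> = indicator (G k) \<omega> * (\<Prod>i<n. if v i \<omega> \<in> A k then 1 - a k else 1)"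
    for k n \<omega>
  have A_sets[measurable]: "A k \<in> sets borel" for k
    by (simp add: A_def)
  have G_F: "G k \<in> sets ?F" for k
  proof -
    have "(\<lambda>\<omega>. measure (\<nu> \<omega>) (A k)) \<in> borel_measurable ?F"
      using measurable_compose[OF measurable_vimage_algebra1 measurable_measure_prob_algebra[OF A_sets]]
        measurable_space[OF \<nu>] by blast
    then have "{\<omega> \<in> space ?F. a k < measure (\<nu> \<omega>) (A k)} \<in> sets ?F"
      by measurable
    then show ?thesis
      by (simp add: G_def)
  qed
  have G_M[measurable]: "G k \<in> sets M" for k
    using G_F subalgebra_vimage_algebra[OF \<nu>] by (auto simp: subalgebra_def)
  \<comment> \<open>On \<open>G k\<close>, \<open>Y k n\<close> dominates the remaining stick: only breaks with \<open>v i > a k\<close> are counted, and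
    each of those as a break of exactly \<open>a k\<close>.\<close>
  have decay: "AE \<omega> in M. eventually (\<lambda>n. Y k n \<omega> < sqrt (1 - a k * a k) ^ n) sequentially" for k
  proof (rule AE_eventually_less_geometric)
    fix n \<omega>
    show "0 \<le> Y k n \<omega>"
      using a[of k] by (auto simp: Y_def intro!: mult_nonneg_nonneg prod_nonneg)
    have "norm (Y k n \<omega>) \<le> 1" for \<omega>
      using a[of k] by (auto simp: Y_def abs_mult abs_prod indicator_def intro!: prod_le_1)
    then show "integrable M (Y k n)"
      by (intro integrable_const_bound[where B = 1]) (auto simp: Y_def[abs_def])
  next
    fix n
    have meas: "(\<lambda>\<omega>. measure (\<nu> \<omega>) (A k)) \<in> borel_measurable M"
      by (rule measurable_compose[OF \<nu> measurable_measure_prob_algebra[OF A_sets]])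
    have bounds: "0 \<le> indicator (G k) \<omega> * (1 - a k * measure (\<nu> \<omega>) (A k)) ^ n"
      "indicator (G k) \<omega> * (1 - a k * measure (\<nu> \<omega>) (A k)) ^ n \<le> (1 - a k * a k) ^ n"
      if \<omega>: "\<omega> \<in> space M" for \<omega>
    proof -
      have "measure (\<nu> \<omega>) (A k) \<le> 1"
        using \<nu>_prob(1)[OF \<omega>] by (rule prob_space.prob_le_1)
      then have nn: "0 \<le> 1 - a k * measure (\<nu> \<omega>) (A k)"
        using a[of k] mult_mono[of "a k" 1 "measure (\<nu> \<omega>) (A k)" 1] by auto
      then show "0 \<le> indicator (G k) \<omega> * (1 - a k * measure (\<nu> \<omega>) (A k)) ^ n"
        by simp
      show "indicator (G k) \<omega> * (1 - a k * measure (\<nu> \<omega>) (A k)) ^ n \<le> (1 - a k * a k) ^ n"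
      proof (cases "\<omega> \<in> G k")
        case True
        then show ?thesis
          using nn a[of k] by (auto simp: G_def intro!: power_mono mult_left_mono)
      next
        case False
        then show ?thesis
          using q[of k] by simp
      qed
    qed
    have "expectation (Y k n) = (\<integral>\<omega>. indicator (G k) \<omega> * (1 - a k * measure (\<nu> \<omega>) (A k)) ^ n \<partial>M)"
      using integral_prod_cond_iid
        [OF \<open>prob_space M\<close> iid A_sets G_F, where n = n and c = "1 - a k"]
      by (simp add: Y_def[abs_def])
    also have "\<dots> \<le> (1 - a k * a k) ^ n"
    proof (rule integral_le_const)
      show "integrable M (\<lambda>\<omega>. indicator (G k) \<omega> * (1 - a k * measure (\<nu> \<omega>) (A k)) ^ n)"
        using bounds meas
        by (intro integrable_const_bound[where B = "(1 - a k * a k) ^ n"]) auto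
    qed (use bounds in auto)
    finally show "expectation (Y k n) \<le> (1 - a k * a k) ^ n" .
  qed (use q in auto)
  then have "AE \<omega> in M. \<forall>k. eventually (\<lambda>n. Y k n \<omega> < sqrt (1 - a k * a k) ^ n) sequentially"
    by (simp add: AE_all_countable)
  with null v01 AE_space show ?thesis
  proof eventually_elim
    case (elim \<omega>)
    interpret \<nu>: prob_space "\<nu> \<omega>"
      by (rule \<nu>_prob(1)[OF elim(3)])
    note [simp] = \<nu>_prob(2)[OF elim(3)]
    \<comment> \<open>The masses of the \<open>A k\<close> increase to 1 while \<open>a k\<close> stays at most \<open>1 / 2\<close>, so \<open>\<omega>\<close> lies in some
      \<open>G k\<close>.\<close>
    have Un: "(\<Union>k. A k) = {0<..}"
    proof safe
      fix x :: real assume "0 < x"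
      then have "eventually (\<lambda>k. a k < x) sequentially"
        by (rule order_tendstoD(2)[OF a_lim])
      then show "x \<in> (\<Union>k. A k)"
        by (auto simp: A_def dest: eventually_happens)
    qed (use a in \<open>auto simp: A_def intro: less_trans\<close>)
    have "incseq A"
      by (auto simp: incseq_def A_def a_def field_simps intro: le_less_trans[rotated])
    then have "(\<lambda>k. measure (\<nu> \<omega>) (A k)) \<longlonglongrightarrow> measure (\<nu> \<omega>) {0<..}"
      unfolding Un[symmetric] by (intro \<nu>.finite_Lim_measure_incseq) auto
    also have "measure (\<nu> \<omega>) {0<..} = 1"
    proof -
      have "{0<..} = space (\<nu> \<omega>) - {..0::real}"
        using sets_eq_imp_space_eq[OF \<nu>_prob(2)[OF elim(3)]] by auto
      then show ?thesis
        using \<nu>.prob_compl[of "{..0}"] elim(1) by simp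
    qed
    finally have "eventually (\<lambda>k. 1 / 2 < measure (\<nu> \<omega>) (A k)) sequentially"
      by (rule order_tendstoD(1)) simp
    then obtain k where "1 / 2 < measure (\<nu> \<omega>) (A k)"
      by (auto dest: eventually_happens)
    moreover have "a k \<le> 1 / 2"
      by (simp add: a_def field_simps)
    ultimately have k: "\<omega> \<in> G k"
      using elim(3) by (simp add: G_def)
    have le: "(\<Prod>j<n. 1 - v j \<omega>) \<le> Y k n \<omega>" for n
      using k elim(2) by (auto simp: Y_def A_def less_imp_le intro!: prod_mono)
    have "eventually (\<lambda>n. Y k n \<omega> < sqrt (1 - a k * a k) ^ n) sequentially"
      using elim(4) by blast
    then have "eventually (\<lambda>n. (\<Prod>j<n. 1 - v j \<omega>) < sqrt (1 - a k * a k) ^ n) sequentially"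
      by eventually_elim (rule le_less_trans[OF le])
    moreover have "0 < sqrt (1 - a k * a k)" "sqrt (1 - a k * a k) < 1"
      using q[of k] by auto
    ultimately show ?case
      by blast
  qed
qed

section \<open>Equality of the two series\<close>

text \<open>A bound under which \<open>x * ln x\<close> inherits geometric decay from \<open>x\<close>.\<close>

lemma abs_mult_ln_le:
  fixes x :: real
  assumes "0 < x" "x \<le> 1"
  shows "\<bar>x * ln x\<bar> \<le> 2 * sqrt x"
proof -
  have "- ln x = 2 * ln (1 / sqrt x)"
    using assms by (simp add: ln_div ln_sqrt)
  also have "\<dots> \<le> 2 * (1 / sqrt x)"
    using assms by (intro mult_left_mono ln_bound) auto
  finally have "x * (- ln x) \<le> x * (2 * (1 / sqrt x))"
    using assms by (intro mult_left_mono) auto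
  also have "\<dots> = 2 * sqrt x"
    using assms real_div_sqrt[of x] by (simp add: field_simps)
  finally show ?thesis
    using assms by (simp add: abs_mult)
qed

lemma summable_of_nat_mult_power:
  fixes r :: real
  assumes "0 \<le> r" "r < 1"
  shows "summable (\<lambda>n. real n * r ^ n)"
proof -
  have "summable (\<lambda>n. diffs (\<lambda>_. 1) n * r ^ n)"
    using assms by (intro termdiff_converges[where K = 1]) (auto simp: summable_geometric)
  then show ?thesis
    by (rule summable_comparison_test[rotated])
       (use assms in \<open>auto simp: diffs_def abs_mult intro!: exI[of _ 0] mult_right_mono\<close>)
qed

text \<open>With \<open>T n = S n * ln (S n / (1 - u) ^ n)\<close>, the single terms satisfy
  \<open>L n = S n * v n * ln (v n / u) + v n * T n\<close> and
  \<open>S n * d(v n \<parallel> u) = L n + (T (Suc n) - T n)\<close>. The first identity gives absolute convergence, since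
  \<open>S\<close> and \<open>T\<close> are absolutely summable, and the second one gives equality of the sums, since
  \<open>T 0 = 0\<close> and \<open>T\<close> tends to 0.\<close>

lemma stick_breaking_divergence_series:
  fixes v :: "nat \<Rightarrow> real" and u r :: real
  defines "S \<equiv> \<lambda>n. \<Prod>j<n. 1 - v j"
  defines "L \<equiv> \<lambda>n. stick_weight v n * ln (stick_weight v n / geometric_weight u n)"
  assumes v: "\<And>n. 0 < v n" "\<And>n. v n < 1" and u: "0 < u" "u < 1"
    and r: "0 < r" "r < 1" and decay: "eventually (\<lambda>n. S n < r ^ n) sequentially"
  shows "summable (\<lambda>n. \<bar>L n\<bar>)"
    and "L sums l \<Longrightarrow> (\<lambda>n. S n * binary_divergence (v n) u) sums l"
proof -
  have S0: "0 < S n" for n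
    using v by (auto simp: S_def intro!: prod_pos)
  have S1: "S n \<le> 1" for n
    using v by (auto simp: S_def less_imp_le intro!: prod_le_1)
  have S_Suc: "S (Suc n) = S n * (1 - v n)" for n
    by (simp add: S_def)
  have stick_S: "stick_weight v n = v n * S n" for n
    by (simp add: stick_weight_def S_def)
  define T where "T n = S n * (ln (S n) - real n * ln (1 - u))" for n
  have L_eq: "L n = S n * (v n * ln (v n) - v n * ln u) + v n * T n" for n
  proof -
    have ln_ratio: "ln (stick_weight v n / geometric_weight u n)
        = ln (v n) + ln (S n) - (ln u + real n * ln (1 - u))"
      unfolding stick_S geometric_weight_def
      using v[of n] u S0[of n] by (simp add: ln_div ln_mult ln_realpow)
    then show ?thesis
      unfolding L_def ln_ratio unfolding T_def stick_S by (simp add: algebra_simps)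
  qed
  have sqrt_r: "0 < sqrt r" "sqrt r < 1"
    using r by auto
  have sum_T: "summable (\<lambda>n. \<bar>T n\<bar>)"
  proof (rule summable_comparison_test_ev)
    show "summable (\<lambda>n. 2 * sqrt r ^ n + \<bar>ln (1 - u)\<bar> * (real n * r ^ n))"
      using r sqrt_r
      by (intro summable_add summable_mult summable_geometric summable_of_nat_mult_power) auto
    show "eventually (\<lambda>n. norm \<bar>T n\<bar> \<le> 2 * sqrt r ^ n + \<bar>ln (1 - u)\<bar> * (real n * r ^ n)) sequentially"
      using decay
    proof eventually_elim
      case (elim n)
      have "\<bar>T n\<bar> \<le> \<bar>S n * ln (S n)\<bar> + \<bar>S n * (real n * ln (1 - u))\<bar>"
        unfolding T_def right_diff_distrib by (rule abs_triangle_ineq4)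
      also have "\<bar>S n * ln (S n)\<bar> \<le> 2 * sqrt (S n)"
        by (rule abs_mult_ln_le[OF S0 S1])
      also have "sqrt (S n) \<le> sqrt r ^ n"
        using elim real_sqrt_le_mono[of "S n" "r ^ n"] by (simp add: real_sqrt_power)
      also have "\<bar>S n * (real n * ln (1 - u))\<bar> = \<bar>ln (1 - u)\<bar> * (real n * S n)"
        using S0[of n] by (simp add: abs_mult)
      also have "\<dots> \<le> \<bar>ln (1 - u)\<bar> * (real n * r ^ n)"
        using elim by (intro mult_left_mono) auto
      finally show ?case
        by simp
    qed
  qed
  have sum_S: "summable S"
    by (rule summable_comparison_test_ev[OF _ summable_geometric[of r]])
       (use r decay S0 in \<open>auto elim!: eventually_mono simp: less_imp_le\<close>)
  show "summable (\<lambda>n. \<bar>L n\<bar>)"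
  proof (rule summable_comparison_test')
    show "summable (\<lambda>n. S n * (2 + \<bar>ln u\<bar>) + \<bar>T n\<bar>)"
      by (intro summable_add summable_mult2 sum_S sum_T)
    fix n :: nat
    have "\<bar>v n * ln (v n)\<bar> \<le> 2 * sqrt (v n)"
      by (rule abs_mult_ln_le) (use v[of n] in auto)
    also have "\<dots> \<le> 2"
      using v[of n] by simp
    finally have 1: "\<bar>v n * ln (v n)\<bar> \<le> 2" .
    have 2: "\<bar>v n * ln u\<bar> \<le> \<bar>ln u\<bar>"
      using v[of n] by (simp add: abs_mult mult_left_le_one_le)
    have 3: "\<bar>v n * T n\<bar> \<le> \<bar>T n\<bar>"
      using v[of n] by (simp add: abs_mult mult_left_le_one_le)
    have "\<bar>L n\<bar> \<le> \<bar>S n * (v n * ln (v n) - v n * ln u)\<bar> + \<bar>v n * T n\<bar>"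
      unfolding L_eq by (rule abs_triangle_ineq)
    also have "\<bar>S n * (v n * ln (v n) - v n * ln u)\<bar> \<le> S n * (2 + \<bar>ln u\<bar>)"
      unfolding abs_mult using S0[of n] 1 2 by (intro mult_mono) auto
    finally show "norm \<bar>L n\<bar> \<le> S n * (2 + \<bar>ln u\<bar>) + \<bar>T n\<bar>"
      using 3 by simp
  qed
  have T_lim: "T \<longlonglongrightarrow> 0"
    using summable_LIMSEQ_zero[OF summable_rabs_cancel[OF sum_T]] .
  have step: "S n * binary_divergence (v n) u = L n + (T (Suc n) - T n)" for n
  proof -
    have divergence: "binary_divergence (v n) u
        = v n * (ln (v n) - ln u) + (1 - v n) * (ln (1 - v n) - ln (1 - u))"
      using v[of n] u by (simp add: binary_divergence_def ln_div)
    have T_Suc: "T (Suc n)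
        = S n * (1 - v n) * (ln (S n) + ln (1 - v n) - (real n + 1) * ln (1 - u))"
      unfolding T_def S_Suc using S0[of n] v[of n] by (simp add: ln_mult)
    show ?thesis
      unfolding L_eq divergence T_Suc unfolding T_def by (simp add: algebra_simps)
  qed
  show "(\<lambda>n. S n * binary_divergence (v n) u) sums l" if "L sums l"
  proof -
    have "T 0 = 0"
      by (simp add: T_def S_def)
    then show ?thesis
      using sums_add[OF that telescope_sums[OF T_lim]] by (simp add: step)
  qed
qed

section \<open>Divergence of atomic measures with common atoms\<close>

text \<open>For distinct atoms, \<open>atomic_measure w z\<close> has the density \<open>w n / w' n\<close> at \<open>z n\<close> with respect to
  \<open>atomic_measure w' z\<close>. Absolute summability is required because the integral that defines the
  divergence is 0 by convention when the integrand is not integrable.\<close>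

lemma KL_divergence_atomic_measure:
  fixes z :: "nat \<Rightarrow> 'a::t1_space" and w w' :: "nat \<Rightarrow> real"
  assumes "inj z" and w: "\<And>n. 0 \<le> w n" and w': "\<And>n. 0 < w' n" and "summable w'"
    and b: "1 < b" and abs: "summable (\<lambda>n. \<bar>w n * log b (w n / w' n)\<bar>)"
  shows "(\<lambda>n. w n * log b (w n / w' n)) sums
    KL_divergence b (atomic_measure w' z) (atomic_measure w z)"
proof -
  define f where "f x = (if x \<in> range z then w (inv z x) / w' (inv z x) else 0)" for x
  have f_z: "f (z n) = w n / w' n" for n
    using \<open>inj z\<close> by (simp add: f_def)
  \<comment> \<open>\<open>f\<close> vanishes off a countable set, and points are closed.\<close>
  have f: "f \<in> borel_measurable borel"
    by (rule measurable_discrete_difference[of "\<lambda>_. 0" borel borel "range z"])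
       (auto simp: f_def)
  let ?C = "count_space (UNIV :: nat set)"
  have atomic: "atomic_measure p z = distr (density ?C (\<lambda>n. ennreal (p n))) borel z" for p
    by (simp add: atomic_measure_def point_measure_def)
  have z: "z \<in> density ?C g \<rightarrow>\<^sub>M borel" for g
    by simp
  interpret sigma_finite_measure "atomic_measure w' z"
  proof -
    have "emeasure (atomic_measure w' z) (space (atomic_measure w' z)) = (\<Sum>n. ennreal (w' n))"
      by (simp add: atomic emeasure_distr emeasure_density nn_integral_count_space_nat)
    also have "\<dots> \<noteq> \<top>"
      using \<open>summable w'\<close> w' by (simp add: ennreal_suminf_neq_top less_imp_le)
    finally have "finite_measure (atomic_measure w' z)"
      by (intro finite_measureI) simp
    then show "sigma_finite_measure (atomic_measure w' z)"
      by (simp add: finite_measure_def)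
  qed
  have "atomic_measure w z = density (atomic_measure w' z) (\<lambda>x. ennreal (f x))"
  proof -
    have "density (atomic_measure w' z) (\<lambda>x. ennreal (f x))
        = distr (density (density ?C (\<lambda>n. ennreal (w' n))) (\<lambda>n. ennreal (f (z n)))) borel z"
      unfolding atomic using f by (intro density_distr) auto
    also have "density (density ?C (\<lambda>n. ennreal (w' n))) (\<lambda>n. ennreal (f (z n)))
        = density ?C (\<lambda>n. ennreal (w n))"
      unfolding f_z using w w'
      by (subst density_density_eq) (auto simp: less_imp_neq[THEN not_sym] less_imp_le simp flip: ennreal_mult)
    finally show ?thesis
      by (simp add: atomic)
  qed
  then have "KL_divergence b (atomic_measure w' z) (atomic_measure w z)
      = (\<integral>x. f x * log b (f x) \<partial>atomic_measure w' z)"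
    using KL_density[OF b, of f] f w w' by (auto simp: f_def less_imp_le atomic)
  also have "\<dots> = (\<integral>n. w n * log b (w n / w' n) \<partial>?C)"
    unfolding atomic using f w'
    by (subst integral_distr) (auto simp: integral_density f_z less_imp_neq[THEN not_sym] less_imp_le)
  finally have KL: "KL_divergence b (atomic_measure w' z) (atomic_measure w z)
      = (\<integral>n. w n * log b (w n / w' n) \<partial>?C)" .
  show ?thesis
    unfolding KL using abs
    by (intro sums_integral_count_space_nat) (simp add: integrable_count_space_nat_iff)
qed

text \<open>By Fubini's theorem the diagonal is a null set for a product of non-atomic laws. It is
  measurable because the Borel sets of the product are the product Borel sets.\<close>

lemma (in prob_space) AE_inj_indep_nonatomic:
  fixes z :: "nat \<Rightarrow> 'a \<Rightarrow> 'b::{second_countable_topology, t2_space}"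
  assumes indep: "indep_vars (\<lambda>_. borel) z UNIV"
    and nonatomic: "\<And>n x. emeasure (distr M borel (z n)) {x} = 0"
  shows "AE \<omega> in M. inj (\<lambda>n. z n \<omega>)"
proof -
  have "AE \<omega> in M. z i \<omega> \<noteq> z j \<omega>" if "i \<noteq> j" for i j
  proof -
    have "indep_var borel ((\<lambda>f. f i) \<circ> (\<lambda>\<omega>. \<lambda>k\<in>{i}. z k \<omega>))
        borel ((\<lambda>f. f j) \<circ> (\<lambda>\<omega>. \<lambda>k\<in>{j}. z k \<omega>))"
      by (rule indep_var_compose[OF indep_var_restrict[OF indep]])
         (use that in \<open>auto intro!: measurable_component_singleton\<close>)
    then have "indep_var borel (z i) borel (z j)"
      by (simp add: comp_def)
    then have [measurable]: "z i \<in> borel_measurable M" "z j \<in> borel_measurable M"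
      and joint: "distr M borel (z i) \<Otimes>\<^sub>M distr M borel (z j)
        = distr M (borel \<Otimes>\<^sub>M borel) (\<lambda>\<omega>. (z i \<omega>, z j \<omega>))"
      by (auto simp: indep_var_distribution_eq)
    interpret zi: prob_space "distr M borel (z i)"
      by (rule prob_space_distr) measurable
    interpret zj: prob_space "distr M borel (z j)"
      by (rule prob_space_distr) measurable
    interpret pair_sigma_finite "distr M borel (z i)" "distr M borel (z j)" ..
    have off_diagonal: "{x :: 'b \<times> 'b. fst x \<noteq> snd x} \<in> sets (borel \<Otimes>\<^sub>M borel)"
      unfolding borel_prod by (intro borel_open open_Collect_neq continuous_intros)
    have "AE y in distr M borel (z j). x \<noteq> y" for x
      by (rule AE_I[of _ _ "{x}"]) (use nonatomic in auto)
    then have "AE x in distr M borel (z i). AE y in distr M borel (z j). x \<noteq> y"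
      by simp
    then have "AE p in distr M borel (z i) \<Otimes>\<^sub>M distr M borel (z j). fst p \<noteq> snd p"
      by (subst AE_pair_iff[symmetric]) (use off_diagonal in \<open>auto simp: space_pair_measure\<close>)
    then show ?thesis
      unfolding joint by (subst (asm) AE_distr_iff) (use off_diagonal in \<open>auto simp: space_pair_measure\<close>)
  qed
  then have "AE \<omega> in M. \<forall>i j. i \<noteq> j \<longrightarrow> z i \<omega> \<noteq> z j \<omega>"
    by (simp add: AE_all_countable)
  then show ?thesis
    by eventually_elim (auto simp: inj_on_def)
qed

section \<open>Divergence of a stick-breaking process from a geometric process\<close>

theorem theorem2:
  fixes M :: "'w measure"
    and \<theta> \<beta> :: real
    and \<nu> :: "'w \<Rightarrow> real measure"
    and v :: "nat \<Rightarrow> 'w \<Rightarrow> real"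
    and u :: "'w \<Rightarrow> real"
    and P\<^sub>0 :: "'a::polish_space measure"
    and z :: "nat \<Rightarrow> 'w \<Rightarrow> 'a"
    and w w' :: "nat \<Rightarrow> 'w \<Rightarrow> real"
    and P P' :: "'w \<Rightarrow> 'a measure"
  assumes "prob_space M"
    and "\<theta> > 0" and "\<beta> > 0"
    \<comment> \<open>the exchangeable sequence \<open>v\<close> and the single length variable \<open>u\<close>, jointly arbitrary\<close>
    and "is_dirichlet_process M \<beta> (beta_distribution 1 \<theta>) \<nu>"
    and "is_cond_iid M borel \<nu> v"
    and "u \<in> borel_measurable M" and "distr M borel u = beta_distribution 1 \<theta>"
    and w: "\<And>n \<omega>. w n \<omega> = stick_weight (\<lambda>j. v j \<omega>) n"
    and w': "\<And>n \<omega>. w' n \<omega> = geometric_weight (u \<omega>) n"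
    \<comment> \<open>i.i.d. locations with non-atomic law, independent of the weights\<close>
    and "prob_space P\<^sub>0" and "sets P\<^sub>0 = sets borel" and "\<And>x. emeasure P\<^sub>0 {x} = 0"
    and "prob_space.indep_vars M (\<lambda>_. borel) z UNIV"
    and "\<And>n. distr M borel (z n) = P\<^sub>0"
    and "prob_space.indep_set M
           (sets (vimage_algebra (space M) (\<lambda>\<omega> n. z n \<omega>) (Pi\<^sub>M UNIV (\<lambda>_. borel))))
           (sets (vimage_algebra (space M) (\<lambda>\<omega>. (\<lambda>n. w n \<omega>, \<lambda>n. w' n \<omega>))
              (Pi\<^sub>M UNIV (\<lambda>_. borel) \<Otimes>\<^sub>M Pi\<^sub>M UNIV (\<lambda>_. borel))))"
    and P: "\<And>\<omega>. P \<omega> = atomic_measure (\<lambda>n. w n \<omega>) (\<lambda>n. z n \<omega>)"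
    and P': "\<And>\<omega>. P' \<omega> = atomic_measure (\<lambda>n. w' n \<omega>) (\<lambda>n. z n \<omega>)"
  \<comment> \<open>the library writes the divergence of \<open>P\<close> from \<open>P'\<close> as \<open>KL_divergence b P' P\<close>\<close>
  shows "AE \<omega> in M.
     (\<lambda>n. w n \<omega> * ln (w n \<omega> / w' n \<omega>)) sums KL_divergence (exp 1) (P' \<omega>) (P \<omega>) \<and>
     (\<lambda>n. (\<Prod>k<n. 1 - v k \<omega>) * binary_divergence (v n \<omega>) (u \<omega>))
       sums KL_divergence (exp 1) (P' \<omega>) (P \<omega>)"
proof -
  interpret prob_space M by fact
  have "AE \<omega> in M. v i \<omega> \<notin> - {0<..<1}" for i
    by (rule AE_cond_iid_not_in_null_set[OF \<open>prob_space M\<close> \<open>is_cond_iid M borel \<nu> v\<close>])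
       (use AE_dirichlet_process_null_set[OF \<open>is_dirichlet_process M \<beta> (beta_distribution 1 \<theta>) \<nu>\<close>]
         in \<open>auto simp: measure_beta_distribution_eq_0\<close>)
  then have v01: "AE \<omega> in M. \<forall>i. 0 < v i \<omega> \<and> v i \<omega> < 1"
    by (simp add: AE_all_countable)
  have "AE \<omega> in M. measure (\<nu> \<omega>) {..0} = 0"
    by (rule AE_dirichlet_process_null_set[OF \<open>is_dirichlet_process M \<beta> (beta_distribution 1 \<theta>) \<nu>\<close>])
       (auto intro!: measure_beta_distribution_eq_0)
  then have decay: "AE \<omega> in M. \<exists>r. 0 < r \<and> r < 1 \<and>
      eventually (\<lambda>n. (\<Prod>j<n. 1 - v j \<omega>) < r ^ n) sequentially"
    using v01
    by (rule AE_stick_remainder_geometric[OF \<open>prob_space M\<close> \<open>is_cond_iid M borel \<nu> v\<close>])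
  have u01: "AE \<omega> in M. 0 < u \<omega> \<and> u \<omega> < 1"
    by (rule AE_distrD[OF \<open>u \<in> borel_measurable M\<close>],
        unfold \<open>distr M borel u = beta_distribution 1 \<theta>\<close>) (rule AE_beta_distribution)
  have inj: "AE \<omega> in M. inj (\<lambda>n. z n \<omega>)"
    by (rule AE_inj_indep_nonatomic) (use assms in auto)
  from v01 u01 decay inj show ?thesis
  proof eventually_elim
    case (elim \<omega>)
    then obtain r where r: "0 < r" "r < 1"
      and small: "eventually (\<lambda>n. (\<Prod>j<n. 1 - v j \<omega>) < r ^ n) sequentially"
      by blast
    let ?L = "\<lambda>n. w n \<omega> * ln (w n \<omega> / w' n \<omega>)"
    have v_pos: "0 < v n \<omega>" and v_lt: "v n \<omega> < 1" for n
      using elim(1) by auto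
    note series = stick_breaking_divergence_series
      [of "\<lambda>n. v n \<omega>", OF v_pos v_lt conjunct1[OF elim(2)] conjunct2[OF elim(2)] r small,
        folded w w']
    have w_nonneg: "0 \<le> w n \<omega>" for n
      unfolding w stick_weight_def using v_pos v_lt
      by (auto intro!: mult_nonneg_nonneg prod_nonneg simp: less_imp_le)
    have w'_pos: "0 < w' n \<omega>" for n
      unfolding w' geometric_weight_def using elim(2) by simp
    have "summable (\<lambda>n. w' n \<omega>)"
      unfolding w' geometric_weight_def using elim(2)
      by (intro summable_mult summable_geometric) auto
    with elim(4) w_nonneg w'_pos have "(\<lambda>n. w n \<omega> * log (exp 1) (w n \<omega> / w' n \<omega>))
        sums KL_divergence (exp 1) (P' \<omega>) (P \<omega>)"
      unfolding P P'
      by (rule KL_divergence_atomic_measure) (use series(1) in \<open>simp_all add: log_def\<close>)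
    then have "?L sums KL_divergence (exp 1) (P' \<omega>) (P \<omega>)"
      by (simp add: log_def)
    then show ?case
      using series(2) by blast
  qed
qed

end
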